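(* Let $B,C\subset\mathbb{R}$ be finite sets with $|B|=N$, $|B+B-B|=KN$ and $|C|=L$. Let $f$ be a convex function (i.e. a $1$-convex function) and $A=f(B)$. Then \[ E(A,C)\ll K^{1/2}NL^{3/2}. \]
   Context: A function $f:\mathbb{R}\to\mathbb{R}$ is $1$-convex if $f\in C^1(\mathbb{R})$ and both $f$ and $f'$ are strictly monotone. $E(A,C)$ is the number of quadruples $(a,c,a',c')\in A\times C\times A\times C$ with $a+c=a'+c'$. $B+B-B=\{b_1+b_2-b_3:b_j\in B\}$. *)

theory Defs
  imports Complex_Main
begin

definition one_convex :: "(real \<Rightarrow> real) \<Rightarrow> bool" where
  "one_convex f \<longleftrightarrow>
     (\<exists>f'. (\<forall>x. (f has_real_derivative f' x) (at x)) \<and> continuous_on UNIV f' \<and>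
        (strict_mono f \<or> strict_mono (\<lambda>x. - f x)) \<and>
        (strict_mono f' \<or> strict_mono (\<lambda>x. - f' x)))"

definition add_energy :: "real set \<Rightarrow> real set \<Rightarrow> nat" where
  "add_energy A C = card {(a, c, a', c'). a \<in> A \<and> c \<in> C \<and> a' \<in> A \<and> c' \<in> C \<and> a + c = a' + c'}"

definition sum_sum_diff :: "real set \<Rightarrow> real set" where
  "sum_sum_diff B = {b1 + b2 - b3 | b1 b2 b3. b1 \<in> B \<and> b2 \<in> B \<and> b3 \<in> B}"

end

theory Submission
  imports Defs
begin

text \<open>
  For a real \<open>x\<close> let \<open>P\<close> be the set of those \<open>b \<in> B\<close> with \<open>x - f b \<in> C\<close>, so that the energy is the sum
  of the squares of \<open>card P\<close>. If \<open>P\<close> has at least \<open>t\<close> elements, then for a positive proportion of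
  the pairs \<open>b < b'\<close> of consecutive elements of \<open>P\<close> there are \<open>O(\<bar>S\<bar> / t)\<close> elements of
  \<open>S = B + B - B\<close> in \<open>(b, b']\<close> and, \<open>f\<close> being monotone, \<open>O(L / t)\<close> elements of \<open>C\<close> between
  \<open>x - f b'\<close> and \<open>x - f b\<close>. Translating the positive elements of \<open>B - B\<close> by \<open>b\<close> maps them into
  \<open>S\<close>, so \<open>b' - b\<close> is among the \<open>O(\<bar>S\<bar> / t)\<close> smallest of them. Since \<open>u \<mapsto> f (u + d) - f u\<close> is
  injective for \<open>d > 0\<close>, the triple \<open>(b' - b, x - f b, x - f b')\<close> determines \<open>x\<close> and \<open>b\<close>. Hence
  there are \<open>O(\<bar>S\<bar> L\<^sup>2 / t\<^sup>3)\<close> such \<open>x\<close>, and summing over \<open>t\<close> gives the bound.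
\<close>

section \<open>Pigeonhole counts in finite sets\<close>

lemma card_large_members_le:
  fixes t :: nat
  assumes "finite P" "finite U" "\<And>p. p \<in> P \<Longrightarrow> J p \<subseteq> U"
    and disj: "\<And>p q. p \<in> P \<Longrightarrow> q \<in> P \<Longrightarrow> p \<noteq> q \<Longrightarrow> J p \<inter> J q = {}"
  shows "4 * card {p \<in> P. 4 * card U < t * card (J p)} \<le> t"
proof (cases "card U = 0")
  case True
  then have "J p = {}" if "p \<in> P" for p
    using assms that by auto
  then have "{p \<in> P. 4 * card U < t * card (J p)} = {}"
    by auto
  then show ?thesis
    by (metis card.empty le0 mult_0_right)
next
  case False
  define Q where "Q = {p \<in> P. 4 * card U < t * card (J p)}"
  have Q: "finite Q" "Q \<subseteq> P"
    using assms by (auto simp: Q_def)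
  \<comment> \<open>Markov's inequality: the disjoint sets \<open>J p\<close> have total size at
    most \<open>card U\<close>, so at most \<open>t / 4\<close> of them can exceed
    \<open>4 * card U / t\<close>.\<close>
  have "card Q * (4 * card U) = (\<Sum>p\<in>Q. 4 * card U)"
    by simp
  also have "\<dots> \<le> (\<Sum>p\<in>Q. t * card (J p))"
    by (rule sum_mono) (auto simp: Q_def)
  also have "\<dots> = t * (\<Sum>p\<in>Q. card (J p))"
    by (simp add: sum_distrib_left)
  also have "(\<Sum>p\<in>Q. card (J p)) = card (\<Union>p\<in>Q. J p)"
  proof (intro card_UN_disjoint[symmetric] ballI impI)
    show "finite (J p)" if "p \<in> Q" for p
      using that Q assms(2,3) by (meson finite_subset subsetD)
    show "J p \<inter> J q = {}" if "p \<in> Q" "q \<in> Q" "p \<noteq> q" for p q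
      using that Q by (intro disj) auto
  qed (rule Q)
  also have "\<dots> \<le> card U"
    using Q assms by (intro card_mono) blast+
  finally have "(4 * card Q) * card U \<le> t * card U"
    by (simp add: mult_ac)
  then show ?thesis
    using False by (simp add: Q_def)
qed

text \<open>All the elements counted lie at or below the largest of them, so their number is at most
  its rank, which satisfies the bound by choice.\<close>

lemma card_low_rank_le:
  fixes V :: "'a::linorder set" and t m :: nat
  assumes "finite V"
  shows "t * card {v \<in> V. t * card {w \<in> V. w \<le> v} \<le> m} \<le> m"
proof (cases "{v \<in> V. t * card {w \<in> V. w \<le> v} \<le> m} = {}")
  case True
  then show ?thesis by (metis card.empty le0 mult_0_right)
next
  case False
  define W where "W = {v \<in> V. t * card {w \<in> V. w \<le> v} \<le> m}"
  have W: "finite W" "W \<noteq> {}"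
    using assms False by (auto simp: W_def)
  have "card W \<le> card {w \<in> V. w \<le> Max W}"
    using assms W by (intro card_mono) (auto simp: W_def)
  moreover have "t * card {w \<in> V. w \<le> Max W} \<le> m"
    using Max_in[OF W] by (simp add: W_def)
  ultimately show ?thesis
    unfolding W_def[symmetric] by (meson le_trans mult_le_mono2)
qed

text \<open>The successor of \<open>p\<close> in \<open>P\<close>. At the maximum of
  \<open>P\<close> this is \<open>Min {}\<close>, hence unspecified, so the maximum is excluded
  wherever the successor is used.\<close>

definition next_in :: "'a::linorder set \<Rightarrow> 'a \<Rightarrow> 'a" where
  "next_in P p = Min {q \<in> P. p < q}"

lemma next_in:
  assumes "finite P" "p \<in> P" "p \<noteq> Max P"
  shows "next_in P p \<in> P" "p < next_in P p"
proof -
  have "p < Max P" "Max P \<in> P"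
    using assms by (auto simp: less_le intro: Max_ge Max_in)
  then have "next_in P p \<in> {q \<in> P. p < q}"
    unfolding next_in_def using assms by (intro Min_in) auto
  then show "next_in P p \<in> P" "p < next_in P p"
    by auto
qed

lemma next_in_le:
  assumes "finite P" "q \<in> P" "p < q"
  shows "next_in P p \<le> q"
  unfolding next_in_def using assms by (intro Min_le) auto

section \<open>Representations of a real as \<open>f b + c\<close>, and the energy\<close>

definition reps :: "(real \<Rightarrow> real) \<Rightarrow> real set \<Rightarrow> real set \<Rightarrow> real \<Rightarrow> real set" where
  "reps f B C x = {b \<in> B. x - f b \<in> C}"

definition image_sumset :: "(real \<Rightarrow> real) \<Rightarrow> real set \<Rightarrow> real set \<Rightarrow> real set" where
  "image_sumset f B C = (\<lambda>(b, c). f b + c) ` (B \<times> C)"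

lemma finite_reps: "finite B \<Longrightarrow> finite (reps f B C x)"
  by (simp add: reps_def)

lemma finite_image_sumset: "finite B \<Longrightarrow> finite C \<Longrightarrow> finite (image_sumset f B C)"
  by (simp add: image_sumset_def)

lemma finite_sum_sum_diff:
  assumes "finite B"
  shows "finite (sum_sum_diff B)"
proof -
  have "sum_sum_diff B = (\<lambda>(x, y, z). x + y - z) ` (B \<times> B \<times> B)"
    by (force simp: sum_sum_diff_def)
  then show ?thesis using assms by simp
qed

text \<open>This is K >= 1. It makes the trivial bound suffice for small \<open>t\<close> and keeps
  the later threshold \<open>T\<close> at least 1.\<close>

lemma card_le_card_sum_sum_diff:
  assumes "finite B"
  shows "card B \<le> card (sum_sum_diff B)"
proof (intro card_mono finite_sum_sum_diff assms subsetI)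
  fix b assume "b \<in> B"
  moreover have "b = b + b - b" by simp
  ultimately show "b \<in> sum_sum_diff B"
    unfolding sum_sum_diff_def by blast
qed

text \<open>A solution of a + c = a' + c' is recovered from its common value x and preimages b, b'
  of a, a', and both preimages lie in \<open>reps f B C x\<close>.\<close>

lemma add_energy_le_sum_reps:
  assumes "finite B" "finite C"
  shows "add_energy (f ` B) C \<le> (\<Sum>x\<in>image_sumset f B C. (card (reps f B C x))\<^sup>2)"
proof -
  let ?T = "SIGMA x:image_sumset f B C. reps f B C x \<times> reps f B C x"
  let ?g = "\<lambda>(x, b, b'). (f b, x - f b, f b', x - f b')"
  have fin: "finite ?T"
    using assms by (intro finite_SigmaI finite_image_sumset finite_cartesian_product finite_reps)
  have "{(a, c, a', c'). a \<in> f ` B \<and> c \<in> C \<and> a' \<in> f ` B \<and> c' \<in> C \<and> a + c = a' + c'} \<subseteq> ?g ` ?T"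
  proof clarify
    fix b c b' c'
    assume *: "b \<in> B" "c \<in> C" "b' \<in> B" "c' \<in> C" "f b + c = f b' + c'"
    define x where "x = f b + c"
    have x: "x - f b = c" "x - f b' = c'"
      using * by (simp_all add: x_def)
    have "x \<in> image_sumset f B C"
      using * by (auto simp: x_def image_sumset_def)
    then have "(x, b, b') \<in> ?T"
      using * x by (simp add: reps_def)
    moreover have "(f b, c, f b', c') = ?g (x, b, b')"
      using x by simp
    ultimately show "(f b, c, f b', c') \<in> ?g ` ?T"
      by (rule rev_image_eqI)
  qed
  then have "add_energy (f ` B) C \<le> card (?g ` ?T)"
    unfolding add_energy_def using fin by (intro card_mono) auto
  also have "\<dots> \<le> card ?T"
    using fin by (rule card_image_le)
  also have "\<dots> = (\<Sum>x\<in>image_sumset f B C. (card (reps f B C x))\<^sup>2)"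
    using assms by (subst card_SigmaI) (auto simp: finite_image_sumset finite_reps card_cartesian_product power2_eq_square)
  finally show ?thesis .
qed

section \<open>Bounds for the number of sums with many representations\<close>

definition rich :: "(real \<Rightarrow> real) \<Rightarrow> real set \<Rightarrow> real set \<Rightarrow> nat \<Rightarrow> real set" where
  "rich f B C t = {x \<in> image_sumset f B C. t \<le> card (reps f B C x)}"

lemma finite_rich: "finite B \<Longrightarrow> finite C \<Longrightarrow> finite (rich f B C t)"
  by (simp add: rich_def finite_image_sumset)

text \<open>Double counting: a pair of a sum x and a representing \<open>b\<close> is determined by
  \<open>(b, x - f b)\<close>. This is the bound used for small \<open>t\<close>.\<close>

lemma card_rich_le:
  assumes "finite B" "finite C"
  shows "t * card (rich f B C t) \<le> card B * card C"
proof -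
  let ?T = "Sigma (rich f B C t) (reps f B C)"
  have "t * card (rich f B C t) \<le> (\<Sum>x\<in>rich f B C t. card (reps f B C x))"
    using sum_mono[of "rich f B C t" "\<lambda>_. t" "\<lambda>x. card (reps f B C x)"]
    by (simp add: rich_def mult.commute)
  also have "\<dots> = card ?T"
    using assms by (simp add: card_SigmaI finite_rich finite_reps)
  also have "\<dots> \<le> card (B \<times> C)"
    using assms by (intro card_inj_on_le[where f = "\<lambda>(x, b). (b, x - f b)"])
      (auto simp: inj_on_def reps_def)
  finally show ?thesis
    by (simp add: card_cartesian_product)
qed

lemma card_rich_cube_le:
  fixes f :: "real \<Rightarrow> real"
  assumes fin: "finite B" "finite C" and mono: "strict_mono f"
    and inj: "\<And>d. d > 0 \<Longrightarrow> inj (\<lambda>u. f (u + d) - f u)"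
  shows "t ^ 3 * card (rich f B C t) \<le> 64 * card (sum_sum_diff B) * (card C)\<^sup>2"
\<comment> \<open>The main argument discards the maximum of \<open>P x\<close> and at most
  \<open>t / 4\<close> elements for each of two reasons. What remains is at least
  \<open>t / 2 - 1\<close>, which is at least \<open>t / 4\<close> once \<open>t\<close> is at least
  4.\<close>
proof (cases "t < 4")
  case True
  have triv: "card B * card C \<le> card (sum_sum_diff B) * (card C)\<^sup>2"
    by (rule mult_le_mono) (use fin card_le_card_sum_sum_diff in \<open>auto simp: power2_eq_square\<close>)
  have "t\<^sup>2 * (t * card (rich f B C t)) \<le> 3\<^sup>2 * (card B * card C)"
    using True by (intro mult_le_mono card_rich_le fin power_mono) auto
  also have "\<dots> \<le> 64 * (card (sum_sum_diff B) * (card C)\<^sup>2)"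
    using triv by simp
  finally show ?thesis
    by (simp add: power2_eq_square power3_eq_cube mult_ac)
next
  case False
  define S where "S = sum_sum_diff B"
  define P where "P = reps f B C"
  define X where "X = rich f B C t"
  define n where "n x b = next_in (P x) b" for x b
  define I where "I x = P x - {Max (P x)}" for x
  \<comment> \<open>Half-open intervals make the sets of distinct \<open>b\<close> disjoint,
    although neighbouring intervals share an endpoint.\<close>
  define J1 where "J1 x b = {s \<in> S. b < s \<and> s \<le> n x b}" for x b
  define J2 where "J2 x b = {c \<in> C. x - f (n x b) < c \<and> c \<le> x - f b}" for x b
  define G where "G x = {b \<in> I x. t * card (J1 x b) \<le> 4 * card S \<and> t * card (J2 x b) \<le> 4 * card C}" for x
  define V where "V = {d. 0 < d \<and> (\<exists>u\<in>B. \<exists>v\<in>B. d = u - v)}"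
  define D where "D = {d \<in> V. t * card {e \<in> V. e \<le> d} \<le> 4 * card S}"
  \<comment> \<open>For fixed \<open>c'\<close>, the low-rank elements of the part of
    \<open>C\<close> above \<open>c'\<close>; the nesting matches the set \<open>V\<close> of
    \<open>card_low_rank_le\<close>.\<close>
  define H where "H c' = {c \<in> {z \<in> C. c' < z}. t * card {z \<in> {z \<in> C. c' < z}. z \<le> c} \<le> 4 * card C}" for c'
  have finS: "finite S"
    using fin by (simp add: S_def finite_sum_sum_diff)
  have finP: "finite (P x)" for x
    using fin by (simp add: P_def finite_reps)
  have finX: "finite X"
    using fin by (simp add: X_def finite_rich)
  have finG: "finite (G x)" for x
    using finP by (simp add: G_def I_def)
  have "V \<subseteq> (\<lambda>(u, v). u - v) ` (B \<times> B)"
    by (auto simp: V_def)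
  then have finV: "finite V"
    using fin finite_subset by blast
  have finH: "finite (H c)" for c
    using fin by (simp add: H_def)
  have f_le: "f u \<le> f v \<longleftrightarrow> u \<le> v" for u v
    using mono by (rule strict_mono_less_eq)
  have n: "n x b \<in> P x" "b < n x b" if "b \<in> I x" for x b
    using next_in[OF finP] that by (auto simp: n_def I_def)
  have n_le: "n x b \<le> b'" if "b' \<in> P x" "b < b'" for x b b'
    using next_in_le[OF finP] that by (auto simp: n_def)
  have G: "t \<le> 4 * card (G x)" if "x \<in> X" for x
  proof -
    define Q1 where "Q1 = {b \<in> I x. 4 * card S < t * card (J1 x b)}"
    define Q2 where "Q2 = {b \<in> I x. 4 * card C < t * card (J2 x b)}"
    have disj1: "J1 x p \<inter> J1 x q = {}" if "p \<in> I x" "q \<in> I x" "p < q" for p q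
      using n_le[of q x p] that by (auto simp: J1_def I_def)
    have disj2: "J2 x p \<inter> J2 x q = {}" if "p \<in> I x" "q \<in> I x" "p < q" for p q
      using n_le[of q x p] f_le[of "n x p" q] that by (auto simp: J2_def I_def)
    have Q1: "4 * card Q1 \<le> t"
      unfolding Q1_def
    proof (rule card_large_members_le)
      fix p q assume "p \<in> I x" "q \<in> I x" "p \<noteq> q"
      then show "J1 x p \<inter> J1 x q = {}"
        using disj1 by (metis inf_commute linorder_neqE)
    qed (use finP finS in \<open>auto simp: I_def J1_def\<close>)
    have Q2: "4 * card Q2 \<le> t"
      unfolding Q2_def
    proof (rule card_large_members_le)
      fix p q assume "p \<in> I x" "q \<in> I x" "p \<noteq> q"
      then show "J2 x p \<inter> J2 x q = {}"
        using disj2 by (metis inf_commute linorder_neqE)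
    qed (use finP fin in \<open>auto simp: I_def J2_def\<close>)
    have "I x \<subseteq> G x \<union> Q1 \<union> Q2"
      by (auto simp: G_def Q1_def Q2_def not_less)
    then have "card (I x) \<le> card (G x \<union> Q1 \<union> Q2)"
      using finP by (intro card_mono) (auto simp: G_def Q1_def Q2_def I_def)
    also have "\<dots> \<le> card (G x) + card Q1 + card Q2"
      by (meson card_Un_le add_le_mono1 le_trans)
    finally have "card (I x) \<le> card (G x) + card Q1 + card Q2" .
    moreover have "t \<le> card (P x)"
      using that by (simp add: X_def rich_def P_def)
    moreover have "card (P x) - 1 \<le> card (I x)"
      unfolding I_def by (simp add: card_Diff_singleton_if)
    ultimately show ?thesis
      using Q1 Q2 False by linarith
  qed
  let ?\<phi> = "\<lambda>(x, b). (n x b - b, x - f (n x b), x - f b)"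
  have inj_\<phi>: "inj_on ?\<phi> (Sigma X G)"
  proof (rule inj_onI, clarify)
    fix x b y b'
    assume "b \<in> G x" "b' \<in> G y" and eq: "n x b - b = n y b' - b'"
      "x - f (n x b) = y - f (n y b')" "x - f b = y - f b'"
    define d where "d = n x b - b"
    have d: "d > 0" "n x b = b + d" "n y b' = b' + d"
      using n[of b x] \<open>b \<in> G x\<close> eq by (auto simp: d_def G_def)
    \<comment> \<open>The last two coordinates differ by the increment of \<open>f\<close> over a
      step of length \<open>d\<close>. With \<open>d\<close> known, this increment determines
      \<open>b\<close>, and then \<open>x - f b\<close> determines \<open>x\<close>.\<close>
    have "f (n x b) - f b = f (n y b') - f b'"
      using eq by linarith
    then have "f (b + d) - f b = f (b' + d) - f b'"
      by (simp only: d(2,3))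
    then have "b = b'"
      using inj[OF d(1)] by (auto dest: injD)
    then show "x = y \<and> b = b'"
      using eq by simp
  qed
  have img: "?\<phi> ` Sigma X G \<subseteq> D \<times> Sigma C H"
  proof clarify
    fix x b assume "x \<in> X" and b: "b \<in> G x"
    then have bI: "b \<in> I x"
      by (simp add: G_def)
    note nb = n[OF bI]
    have B: "b \<in> B" "n x b \<in> B" and C: "x - f b \<in> C" "x - f (n x b) \<in> C"
      using nb bI by (auto simp: P_def reps_def I_def)
    have lt: "f b < f (n x b)"
      using mono nb by (simp add: strict_mono_less)
    \<comment> \<open>The point where \<open>B + B - B\<close> enters: translation by
      \<open>b\<close> carries all positive differences up to the gap into \<open>J1 x b\<close>, so
      the gap has low rank in \<open>V\<close>.\<close>
    have "card {e \<in> V. e \<le> n x b - b} \<le> card (J1 x b)"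
    proof (rule card_inj_on_le)
      show "inj_on (\<lambda>e. b + e) {e \<in> V. e \<le> n x b - b}"
        by simp
      show "(\<lambda>e. b + e) ` {e \<in> V. e \<le> n x b - b} \<subseteq> J1 x b"
      proof clarify
        fix e assume e: "e \<in> V" "e \<le> n x b - b"
        then obtain u v where uv: "u \<in> B" "v \<in> B" "e = u - v"
          by (auto simp: V_def)
        have "b + e = b + u - v"
          using uv by simp
        then have "b + e \<in> S"
          unfolding S_def sum_sum_diff_def using B uv by blast
        then show "b + e \<in> J1 x b"
          using e by (simp add: J1_def V_def)
      qed
      show "finite (J1 x b)"
        using finS by (simp add: J1_def)
    qed
    then have "t * card {e \<in> V. e \<le> n x b - b} \<le> t * card (J1 x b)"
      by (rule mult_le_mono2)
    also have "\<dots> \<le> 4 * card S"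
      using b by (simp add: G_def)
    finally have "t * card {e \<in> V. e \<le> n x b - b} \<le> 4 * card S" .
    then have "n x b - b \<in> D"
      using B nb by (auto simp: D_def V_def)
    \<comment> \<open>The rank of \<open>x - f b\<close> among the elements of \<open>C\<close>
      above \<open>x - f (n x b)\<close> is exactly \<open>card (J2 x b)\<close>.\<close>
    moreover have "{z \<in> {z \<in> C. x - f (n x b) < z}. z \<le> x - f b} = J2 x b"
      by (auto simp: J2_def)
    then have "x - f b \<in> H (x - f (n x b))"
      using b C lt by (simp add: H_def G_def)
    ultimately show "n x b - b \<in> D \<and> (x - f (n x b), x - f b) \<in> Sigma C H"
      using C by simp
  qed
  have "t * card X \<le> 4 * card (Sigma X G)"
    using sum_mono[of X "\<lambda>_. t" "\<lambda>x. 4 * card (G x)"] G finX finG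
    by (simp add: card_SigmaI sum_distrib_left mult.commute)
  also have "card (Sigma X G) \<le> card (D \<times> Sigma C H)"
    using inj_\<phi> img finV fin finH
    by (intro card_inj_on_le) (auto simp: D_def)
  also have "\<dots> = card D * card (Sigma C H)"
    by (rule card_cartesian_product)
  finally have *: "t * card X \<le> 4 * (card D * card (Sigma C H))"
    by simp
  have D: "t * card D \<le> 4 * card S"
    unfolding D_def by (rule card_low_rank_le[OF finV])
  have "t * card (Sigma C H) = (\<Sum>c\<in>C. t * card (H c))"
    using fin finH by (simp add: card_SigmaI sum_distrib_left)
  also have "\<dots> \<le> (\<Sum>c\<in>C. 4 * card C)"
    unfolding H_def using fin by (intro sum_mono card_low_rank_le) auto
  finally have H: "t * card (Sigma C H) \<le> 4 * (card C)\<^sup>2"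
    by (simp add: power2_eq_square mult_ac)
  \<comment> \<open>One factor \<open>t\<close> goes to the number of good \<open>b\<close> per x,
    one to \<open>D\<close> and one to \<open>H\<close>. Each costs a factor 4, whence 64.\<close>
  have "t ^ 3 * card X = t\<^sup>2 * (t * card X)"
    by (simp add: power2_eq_square power3_eq_cube)
  also have "\<dots> \<le> t\<^sup>2 * (4 * (card D * card (Sigma C H)))"
    using * by (rule mult_le_mono2)
  also have "\<dots> = 4 * ((t * card D) * (t * card (Sigma C H)))"
    by (simp add: power2_eq_square)
  also have "\<dots> \<le> 4 * ((4 * card S) * (4 * (card C)\<^sup>2))"
    by (intro mult_le_mono2 mult_le_mono[OF D H])
  finally show ?thesis
    by (simp add: S_def X_def)
qed

section \<open>Summation over the richness \<open>t\<close>\<close>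

lemma power2_le_sum_upto: "n\<^sup>2 \<le> (\<Sum>t = 1..n. 2 * t)" for n :: nat
  by (induction n) (auto simp: power2_eq_square)

text \<open>Layer-cake summation: each square is at most the sum of \<open>2 * t\<close> over the
  levels \<open>t\<close> it reaches, and exchanging the sums counts the rich x at each
  level.\<close>

lemma sum_reps_le_sum_rich:
  assumes "finite B" "finite C"
  shows "(\<Sum>x\<in>image_sumset f B C. (card (reps f B C x))\<^sup>2) \<le> (\<Sum>t = 1..card B. 2 * t * card (rich f B C t))"
proof -
  have "(\<Sum>x\<in>image_sumset f B C. (card (reps f B C x))\<^sup>2)
      \<le> (\<Sum>x\<in>image_sumset f B C. \<Sum>t = 1..card B. if t \<le> card (reps f B C x) then 2 * t else 0)"
  proof (rule sum_mono)
    fix x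
    have "card (reps f B C x) \<le> card B"
      using assms by (intro card_mono) (auto simp: reps_def)
    then have "{1..card (reps f B C x)} = {t \<in> {1..card B}. t \<le> card (reps f B C x)}"
      by auto
    then have "(\<Sum>t = 1..card B. if t \<le> card (reps f B C x) then 2 * t else 0)
        = (\<Sum>t = 1..card (reps f B C x). 2 * t)"
      by (simp only: sum.inter_filter[OF finite_atLeastAtMost])
    then show "(card (reps f B C x))\<^sup>2
        \<le> (\<Sum>t = 1..card B. if t \<le> card (reps f B C x) then 2 * t else 0)"
      using power2_le_sum_upto by metis
  qed
  also have "\<dots> = (\<Sum>t = 1..card B. \<Sum>x\<in>image_sumset f B C. if t \<le> card (reps f B C x) then 2 * t else 0)"
    by (rule sum.swap)
  also have "\<dots> = (\<Sum>t = 1..card B. 2 * t * card (rich f B C t))"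
    using assms by (simp add: rich_def finite_image_sumset mult.commute flip: sum.inter_filter)
  finally show ?thesis .
qed

text \<open>The constant bound is used up to the cutoff \<open>k\<close> and the inverse-square
  bound beyond it, where 1/(s+1)^2 <= 1/s - 1/(s+1) telescopes.\<close>

lemma sum_le_of_inverse_square_bound:
  fixes u :: "nat \<Rightarrow> real" and \<alpha> \<beta> :: real and k :: nat
  assumes "k > 0" "\<alpha> \<ge> 0" "\<beta> \<ge> 0"
    and \<alpha>: "\<And>t. t > 0 \<Longrightarrow> u t \<le> \<alpha>" and \<beta>: "\<And>t. t > 0 \<Longrightarrow> u t \<le> \<beta> / (real t)\<^sup>2"
  shows "(\<Sum>t = 1..n. u t) \<le> k * \<alpha> + \<beta> / k"
proof -
  have init: "(\<Sum>t = 1..m. u t) \<le> m * \<alpha>" for m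
    using sum_mono[of "{1..m}" u "\<lambda>_. \<alpha>"] \<alpha> by simp
  \<comment> \<open>Keeping the negative last term of the telescoping sum is what lets the induction
    close.\<close>
  have tail: "(\<Sum>t = 1..k + j. u t) \<le> k * \<alpha> + \<beta> / k - \<beta> / (k + j)" for j
  proof (induction j)
    case 0
    then show ?case using init[of k] by simp
  next
    case (Suc j)
    define s where "s = real (k + j)"
    have s: "s > 0"
      using assms by (simp add: s_def)
    then have "s * (s + 1) \<le> (s + 1)\<^sup>2"
      by (simp add: power2_eq_square algebra_simps)
    then have "\<beta> / (s + 1)\<^sup>2 \<le> \<beta> / (s * (s + 1))"
      using s assms by (intro divide_left_mono) auto
    also have "\<dots> = \<beta> / s - \<beta> / (s + 1)"
      using s by (simp add: field_simps)
    finally have "u (k + Suc j) \<le> \<beta> / s - \<beta> / (s + 1)"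
      using \<beta>[of "k + Suc j"] by (simp add: s_def add_ac)
    then show ?case
      using Suc by (simp add: s_def add_ac)
  qed
  show ?thesis
  proof (cases "n \<le> k")
    case True
    have "(\<Sum>t = 1..n. u t) \<le> n * \<alpha>"
      by (rule init)
    also have "\<dots> \<le> k * \<alpha>"
      using True assms by (intro mult_right_mono) auto
    also have "\<dots> \<le> k * \<alpha> + \<beta> / k"
      using assms by simp
    finally show ?thesis .
  next
    case False
    then have "(\<Sum>t = 1..n. u t) \<le> k * \<alpha> + \<beta> / k - \<beta> / n"
      using tail[of "n - k"] by simp
    also have "\<dots> \<le> k * \<alpha> + \<beta> / k"
      using assms by simp
    finally show ?thesis .
  qed
qed

text \<open>Assuming injective increments rather than a monotone derivative covers increasing and
  decreasing derivatives at once.\<close>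

lemma add_energy_le_of_strict_mono:
  fixes f :: "real \<Rightarrow> real"
  assumes fin: "finite B" "finite C" and mono: "strict_mono f"
    and inj: "\<And>d. d > 0 \<Longrightarrow> inj (\<lambda>u. f (u + d) - f u)"
    and ne: "B \<noteq> {}" "C \<noteq> {}"
  defines "N \<equiv> real (card B)" and "L \<equiv> real (card C)"
  defines "K \<equiv> real (card (sum_sum_diff B)) / N"
  shows "real (add_energy (f ` B) C) \<le> 132 * sqrt K * N * L powr (3/2)"
proof -
  have N: "N > 0" and L: "L \<ge> 1"
    using fin ne by (auto simp: N_def L_def card_gt_0_iff Suc_le_eq)
  have S: "real (card (sum_sum_diff B)) = K * N"
    using N by (simp add: K_def)
  have K: "K \<ge> 1"
    using card_le_card_sum_sum_diff[OF fin(1)] N by (simp add: K_def N_def)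
  \<comment> \<open>The two bounds for the number of \<open>t\<close>-rich sums coincide up to a constant at \<open>t = T\<close>.\<close>
  define T where "T = sqrt (K * L)"
  have T: "T \<ge> 1" "T\<^sup>2 = K * L"
    using K L mult_mono[of 1 K 1 L] by (auto simp: T_def)
  \<comment> \<open>Rounding up costs at most a factor 2 because \<open>T\<close> is at least
    1.\<close>
  define k where "k = nat \<lceil>T\<rceil>"
  have k: "T \<le> k" "k \<le> 2 * T" "k > 0"
    using T by (auto simp: k_def) linarith+
  define u where "u t = real (2 * t * card (rich f B C t))" for t
  have "real (add_energy (f ` B) C) \<le> (\<Sum>t = 1..card B. u t)"
    unfolding u_def of_nat_sum[symmetric] of_nat_le_iff
    using add_energy_le_sum_reps[OF fin] sum_reps_le_sum_rich[OF fin] by (rule le_trans)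
  also have "\<dots> \<le> k * (2 * N * L) + 128 * (K * N) * L\<^sup>2 / k"
  proof (rule sum_le_of_inverse_square_bound)
    fix t :: nat assume t: "t > 0"
    have "real (t * card (rich f B C t)) \<le> real (card B * card C)"
      using card_rich_le[OF fin] by (simp only: of_nat_le_iff)
    then show "u t \<le> 2 * N * L"
      by (simp add: u_def N_def L_def)
    have "real (t ^ 3 * card (rich f B C t)) \<le> real (64 * card (sum_sum_diff B) * (card C)\<^sup>2)"
      using card_rich_cube_le[OF fin mono inj] by (simp only: of_nat_le_iff)
    then have "(real t)\<^sup>2 * u t \<le> 128 * (K * N) * L\<^sup>2"
      by (simp add: u_def L_def S[symmetric] power2_eq_square power3_eq_cube mult_ac)
    then show "u t \<le> 128 * (K * N) * L\<^sup>2 / (real t)\<^sup>2"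
      using t by (simp add: pos_le_divide_eq mult.commute)
  qed (use k N K L in auto)
  also have "\<dots> \<le> (2 * T) * (2 * N * L) + 128 * (K * N) * L\<^sup>2 / T"
    using k T N K L by (intro add_mono mult_right_mono divide_left_mono) auto
  also have "128 * (K * N) * L\<^sup>2 / T = 128 * N * L * (K * L) / T"
    by (simp add: power2_eq_square)
  also have "\<dots> = 128 * N * L * T"
    using T by (simp add: power2_eq_square flip: T(2))
  \<comment> \<open>The constant is 4 + 128, and \<open>T\<close> splits as
    \<open>sqrt K * sqrt L\<close>.\<close>
  also have "(2 * T) * (2 * N * L) + 128 * N * L * T = 132 * sqrt K * N * (L * sqrt L)"
    by (simp add: T_def real_sqrt_mult)
  also have "L * sqrt L = L powr 1 * L powr (1/2)"
    using L by (simp add: powr_half_sqrt)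
  also have "\<dots> = L powr (3/2)"
    using powr_add[of L 1 "1/2"] by simp
  finally show ?thesis .
qed

section \<open>Injectivity of increments from convexity\<close>

lemma inj_shift_diff:
  fixes f f' :: "real \<Rightarrow> real"
  assumes der: "\<And>x. (f has_real_derivative f' x) (at x)"
    and mono: "strict_mono f'" and "d > 0"
  shows "inj (\<lambda>u. f (u + d) - f u)"
proof -
  \<comment> \<open>The increment is strictly increasing in \<open>u\<close>, since its derivative
    is an increment of the increasing function \<open>f'\<close>.\<close>
  have der_diff: "((\<lambda>u. f (u + d) - f u) has_real_derivative f' (u + d) - f' u) (at u)" for u
    using DERIV_diff[OF DERIV_shift[THEN iffD1, OF der] der] .
  have pos: "f' (u + d) - f' u > 0" for u
    using mono \<open>d > 0\<close> by (simp add: strict_mono_less)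
  have "strict_mono (\<lambda>u. f (u + d) - f u)"
  proof (rule strict_monoI)
    fix u v :: real
    assume "u < v"
    then show "f (u + d) - f u < f (v + d) - f v"
      by (rule DERIV_pos_imp_increasing) (use der_diff pos in metis)
  qed
  then show ?thesis
    by (rule strict_mono_imp_inj_on)
qed

lemma one_convex_inj_shift_diff:
  assumes "one_convex f" "d > 0"
  shows "inj (\<lambda>u. f (u + d) - f u)"
proof -
  obtain f' where der: "\<And>x. (f has_real_derivative f' x) (at x)"
    and "strict_mono f' \<or> strict_mono (\<lambda>x. - f' x)"
    using assms by (auto simp: one_convex_def)
  then consider "strict_mono f'" | "strict_mono (\<lambda>x. - f' x)"
    by blast
  then show ?thesis
  proof cases
    case 1
    then show ?thesis
      by (rule inj_shift_diff[OF der _ \<open>d > 0\<close>])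
  next
    \<comment> \<open>Here \<open>- f\<close> has increasing derivative, and injectivity of the
      negated increment gives that of the increment.\<close>
    case 2
    have "((\<lambda>x. - f x) has_real_derivative - f' x) (at x)" for x
      using der by (rule DERIV_minus)
    then have "inj (\<lambda>u. - f (u + d) - - f u)"
      using 2 \<open>d > 0\<close> by (rule inj_shift_diff)
    also have "(\<lambda>u. - f (u + d) - - f u) = uminus \<circ> (\<lambda>u. f (u + d) - f u)"
      by (simp add: fun_eq_iff)
    finally show ?thesis
      by (rule inj_on_imageI2)
  qed
qed

section \<open>Reflection, and the final estimate\<close>

lemma one_convex_uminus:
  assumes "one_convex f"
  shows "one_convex (\<lambda>x. - f x)"
proof -
  obtain f' where "\<And>x. (f has_real_derivative f' x) (at x)" "continuous_on UNIV f'"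
    "strict_mono f \<or> strict_mono (\<lambda>x. - f x)" "strict_mono f' \<or> strict_mono (\<lambda>x. - f' x)"
    using assms by (auto simp: one_convex_def)
  then show ?thesis
    unfolding one_convex_def
    by (intro exI[of _ "\<lambda>x. - f' x"]) (auto intro: DERIV_minus continuous_on_minus)
qed

text \<open>Reduces decreasing \<open>f\<close> to increasing \<open>- f\<close>: \<open>C\<close>
  is reflected too, while \<open>B\<close>, and with it K, is unchanged.\<close>

lemma add_energy_uminus: "add_energy (uminus ` A) (uminus ` C) = add_energy A C"
  unfolding add_energy_def
  by (rule bij_betw_same_card[of "\<lambda>(a, c, a', c'). (- a, - c, - a', - c')"],
      rule bij_betw_byWitness[where f' = "\<lambda>(a, c, a', c'). (- a, - c, - a', - c')"])
     (auto simp: algebra_simps)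

theorem theorem1p7:
  shows "\<exists>c>0. \<forall>(B::real set) (C::real set) (f::real \<Rightarrow> real).
     finite B \<longrightarrow> finite C \<longrightarrow> one_convex f \<longrightarrow>
     (let N = real (card B); K = real (card (sum_sum_diff B)) / N; L = real (card C) in
       real (add_energy (f ` B) C) \<le> c * sqrt K * N * L powr (3/2))"
proof (intro exI[of _ 132] conjI allI impI)
  fix B C :: "real set" and f :: "real \<Rightarrow> real"
  assume fin: "finite B" "finite C" and f: "one_convex f"
  have "real (add_energy (f ` B) C)
    \<le> 132 * sqrt (real (card (sum_sum_diff B)) / real (card B)) * real (card B) * real (card C) powr (3/2)"
  proof (cases "B = {} \<or> C = {}")
    \<comment> \<open>The energy vanishes and the right-hand side is 0 as well; for empty
      \<open>B\<close> the quotient K is 0 / 0, which is 0 in HOL.\<close>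
    case True
    then have "add_energy (f ` B) C = 0"
      by (auto simp: add_energy_def)
    then show ?thesis by simp
  next
    case False
    from f consider "strict_mono f" | "strict_mono (\<lambda>x. - f x)"
      by (auto simp: one_convex_def)
    then show ?thesis
    proof cases
      case 1
      then show ?thesis
        using add_energy_le_of_strict_mono fin one_convex_inj_shift_diff[OF f] False by blast
    next
      case 2
      have "real (add_energy ((\<lambda>x. - f x) ` B) (uminus ` C))
        \<le> 132 * sqrt (real (card (sum_sum_diff B)) / real (card B)) * real (card B)
            * real (card (uminus ` C)) powr (3/2)"
        using 2 fin one_convex_inj_shift_diff[OF one_convex_uminus[OF f]] False
        by (intro add_energy_le_of_strict_mono) auto
      moreover have "(\<lambda>x. - f x) ` B = uminus ` (f ` B)"
        by (simp add: image_image)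
      ultimately show ?thesis
        by (simp add: add_energy_uminus card_image)
    qed
  qed
  then show "let N = real (card B); K = real (card (sum_sum_diff B)) / N; L = real (card C) in
       real (add_energy (f ` B) C) \<le> 132 * sqrt K * N * L powr (3/2)"
    by (simp add: Let_def)
qed simp

end
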